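(* Let $G=(V,E)$ be a complete directed graph with $|V|\ge2$ (both arcs $(u,v)$ and $(v,u)$ present for all distinct $u,v\in V$), and let $w:2^E\to\mathbb{R}_{\ge0}$ be a monotone submodular function with curvature $\kappa\in[0,1]$. The directed matching-based tour algorithm (defined in the context) outputs a directed Hamiltonian cycle $T$ of $G$ with $$w(T)\ \ge\ \max\left\{\frac{1}{2(2+\kappa)},\ \frac12(1-\kappa)\right\}\ \max_{S\in\mathcal{H}}w(S),$$ where $\mathcal{H}$ is the set of (arc sets of) all directed Hamiltonian cycles of $G$.
   Context: A function $w$ is submodular if $w(S)+w(T)\ge w(S\cup T)+w(S\cap T)$ for all $S,T\subseteq E$, and monotone if $A\subseteq B$ implies $w(A)\le w(B)$. Write $\Delta_A(e)=w(A\cup\{e\})-w(A)$. The function $w$ has curvature $\kappa\in[0,1]$ if $\Delta_A(e)\ge(1-\kappa)w(\{e\})$ for every $A\subset E$, $e\in E\setminus A$. Let $\mathcal{F}$ be the family of arc sets in which every vertex has in-degree at most $1$ and out-degree at most $1$ (the intersection of two partition matroids). Directed matching-based tour algorithm: (1) Compute $M_1\in\mathcal{F}$ greedily: repeatedly take the not-yet-considered arc with largest marginal benefit $\Delta_{M_1}(e)$ and add it if the result stays in $\mathcal{F}$, otherwise discard it. Compute $M_2$ as an optimal solution of the maximum assignment problem with weight matrix $\tilde W_{uv}=w(\{(u,v)\})$ for $u\ne v$ and $\tilde W_{uu}=-\infty$ (e.g. by the Hungarian algorithm), viewed as an arc set. Let $M$ be whichever of $M_1,M_2$ has larger value of $w$;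 it is a vertex-disjoint union of directed cycles (each of length at least $2$), plus possibly one isolated vertex. (2) Let $A^1,\dots,A^m$ be the arc sets of the cycles of $M$, $k=\min_j|A^j|$, and enumerate $A^j=\{a^j_1,\dots,a^j_{n_j}\}$. For $i=1,2,\dots$ set $U=\{a^1_i,\dots,a^m_i\}$, stopping at the first $i$ with $w(M\setminus U)\ge\frac{k-1}{k}w(M)$. (3) Connect the vertex-disjoint directed paths of $M\setminus U$ (including isolated vertices) arbitrarily into a directed Hamiltonian cycle by adding arcs. *)

theory Defs
  imports "HOL-Library.Extended_Real" "Graph_Theory.Graph_Theory"
begin

section \<open>Set functions\<close>

definition submodular :: "'e set \<Rightarrow> ('e set \<Rightarrow> real) \<Rightarrow> bool" where
  "submodular E w \<longleftrightarrow> (\<forall>S \<subseteq> E. \<forall>T \<subseteq> E. w (S \<union> T) + w (S \<inter> T) \<le> w S + w T)"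

definition marginal :: "('e set \<Rightarrow> real) \<Rightarrow> 'e set \<Rightarrow> 'e \<Rightarrow> real" where
  "marginal w A e = w (insert e A) - w A"

definition has_curvature :: "'e set \<Rightarrow> ('e set \<Rightarrow> real) \<Rightarrow> real \<Rightarrow> bool" where
  "has_curvature E w \<kappa> \<longleftrightarrow>
     0 \<le> \<kappa> \<and> \<kappa> \<le> 1 \<and> (\<forall>A e. A \<subset> E \<longrightarrow> e \<in> E - A \<longrightarrow> marginal w A e \<ge> (1 - \<kappa>) * w {e})"


section \<open>Arc sets\<close>

abbreviation spanning_sub :: "'v pair_pre_digraph \<Rightarrow> 'v rel \<Rightarrow> ('v, 'v \<times> 'v) pre_digraph" where
  "spanning_sub G A \<equiv> with_proj (G\<lparr>parcs := A\<rparr>)"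

definition matching_family :: "'v pair_pre_digraph \<Rightarrow> 'v rel set" where
  "matching_family G = {A. A \<subseteq> parcs G \<and>
     (\<forall>v \<in> pverts G. in_degree (spanning_sub G A) v \<le> 1 \<and> out_degree (spanning_sub G A) v \<le> 1)}"

definition cycle_arc_sets :: "'v pair_pre_digraph \<Rightarrow> 'v rel \<Rightarrow> 'v rel set" where
  "cycle_arc_sets G A = set ` {p. pre_digraph.cycle (spanning_sub G A) p}"

text \<open>Every vertex of a closed walk is the tail of one of its arcs.\<close>

definition hamiltonian_cycles :: "'v pair_pre_digraph \<Rightarrow> 'v rel set" where
  "hamiltonian_cycles G = {C \<in> cycle_arc_sets G (parcs G). fst ` C = pverts G}"


section \<open>The assignment problem\<close>

definition assignment_weight :: "('v rel \<Rightarrow> real) \<Rightarrow> 'v \<Rightarrow> 'v \<Rightarrow> ereal" where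
  "assignment_weight w u v = (if u = v then - \<infinity> else ereal (w {(u, v)}))"

definition optimal_assignment :: "'v pair_pre_digraph \<Rightarrow> ('v rel \<Rightarrow> real) \<Rightarrow> ('v \<Rightarrow> 'v) \<Rightarrow> bool" where
  "optimal_assignment G w \<sigma> \<longleftrightarrow>
     is_arg_max (\<lambda>\<tau>. \<Sum>u \<in> pverts G. assignment_weight w u (\<tau> u))
                (\<lambda>\<tau>. bij_betw \<tau> (pverts G) (pverts G)) \<sigma>"


section \<open>The algorithm\<close>

text \<open>An enumeration \<open>en\<close> lists the arcs of a cycle \<open>A\<close> as \<open>en A 1, \<dots>, en A (card A)\<close>.\<close>

type_synonym 'v enumeration = "'v rel \<Rightarrow> nat \<Rightarrow> 'v \<times> 'v"

definition enumerates_cycles :: "'v pair_pre_digraph \<Rightarrow> 'v rel \<Rightarrow> 'v enumeration \<Rightarrow> bool" where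
  "enumerates_cycles G M en \<longleftrightarrow> (\<forall>A \<in> cycle_arc_sets G M. bij_betw (en A) {1..card A} A)"

definition min_cycle_length :: "'v pair_pre_digraph \<Rightarrow> 'v rel \<Rightarrow> nat" where
  "min_cycle_length G M = Min (card ` cycle_arc_sets G M)"

definition transversal :: "'v pair_pre_digraph \<Rightarrow> 'v rel \<Rightarrow> 'v enumeration \<Rightarrow> nat \<Rightarrow> 'v rel" where
  "transversal G M en i = (\<lambda>A. en A i) ` cycle_arc_sets G M"

definition removal_ok ::
  "'v pair_pre_digraph \<Rightarrow> ('v rel \<Rightarrow> real) \<Rightarrow> 'v rel \<Rightarrow> 'v enumeration \<Rightarrow> nat \<Rightarrow> bool" where
  "removal_ok G w M en i \<longleftrightarrow>
     w (M - transversal G M en i) \<ge>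
       (real (min_cycle_length G M) - 1) / real (min_cycle_length G M) * w M"

text \<open>The list \<open>ps\<close> consists of the vertex sequences, in some order, of vertex-disjoint directed
  paths which together have all vertices of \<open>G\<close> and exactly the arcs \<open>P\<close>; an isolated vertex \<open>v\<close>
  is the path \<open>[v]\<close>.\<close>

definition path_partition :: "'v pair_pre_digraph \<Rightarrow> 'v rel \<Rightarrow> 'v list list \<Rightarrow> bool" where
  "path_partition G P ps \<longleftrightarrow>
     (\<forall>p \<in> set ps. vpath p (spanning_sub G P)) \<and>
     distinct (concat ps) \<and> set (concat ps) = pverts G \<and>
     (\<Union>p \<in> set ps. set (vwalk_arcs p)) = P"

text \<open>Join the paths one after the other and the last to the first.\<close>

definition close_up :: "'v list list \<Rightarrow> 'v rel" where
  "close_up ps = set (vwalk_arcs (concat ps @ [hd (concat ps)]))"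

text \<open>All choices the algorithm leaves open (ties, the optimal assignment, the enumerations, the
  connecting order) are nondeterministic. A step that the algorithm cannot carry out (for instance
  when some cycle has no \<open>i\<close>-th arc, or the remaining arcs do not form disjoint paths) has no
  successor state.

  \<open>Greedy M R\<close>: current set \<open>M\<close>, not yet considered arcs \<open>R\<close>;
  \<open>Assign M\<^sub>1\<close>: the greedy phase has ended with \<open>M\<^sub>1\<close>;
  \<open>Select M\<^sub>1 M\<^sub>2\<close>: both candidates are computed;
  \<open>Scan M en i\<close>: about to test the \<open>i\<close>-th transversal;
  \<open>Connect P\<close>: \<open>P\<close> is what remains of \<open>M\<close>.\<close>

datatype 'v tour_state =
    Greedy "'v rel" "'v rel"
  | Assign "'v rel"
  | Select "'v rel" "'v rel"
  | Scan "'v rel" "'v enumeration" nat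
  | Connect "'v rel"
  | Output "'v rel"

inductive tour_step ::
  "'v pair_pre_digraph \<Rightarrow> ('v rel \<Rightarrow> real) \<Rightarrow> 'v tour_state \<Rightarrow> 'v tour_state \<Rightarrow> bool"
  for G :: "'v pair_pre_digraph" and w :: "'v rel \<Rightarrow> real" where
  greedy_add:
    "is_arg_max (marginal w M) (\<lambda>e. e \<in> R) e \<Longrightarrow> insert e M \<in> matching_family G \<Longrightarrow>
     tour_step G w (Greedy M R) (Greedy (insert e M) (R - {e}))"
| greedy_discard:
    "is_arg_max (marginal w M) (\<lambda>e. e \<in> R) e \<Longrightarrow> insert e M \<notin> matching_family G \<Longrightarrow>
     tour_step G w (Greedy M R) (Greedy M (R - {e}))"
| greedy_done:
    "tour_step G w (Greedy M {}) (Assign M)"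
| assign:
    "optimal_assignment G w \<sigma> \<Longrightarrow>
     tour_step G w (Assign M\<^sub>1) (Select M\<^sub>1 ((\<lambda>u. (u, \<sigma> u)) ` pverts G))"
| select:
    "M \<in> {M\<^sub>1, M\<^sub>2} \<Longrightarrow> w M = max (w M\<^sub>1) (w M\<^sub>2) \<Longrightarrow> enumerates_cycles G M en \<Longrightarrow>
     tour_step G w (Select M\<^sub>1 M\<^sub>2) (Scan M en 1)"
| scan_next:
    "\<forall>A \<in> cycle_arc_sets G M. i \<le> card A \<Longrightarrow> \<not> removal_ok G w M en i \<Longrightarrow>
     tour_step G w (Scan M en i) (Scan M en (Suc i))"
| scan_stop:
    "\<forall>A \<in> cycle_arc_sets G M. i \<le> card A \<Longrightarrow> removal_ok G w M en i \<Longrightarrow>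
     tour_step G w (Scan M en i) (Connect (M - transversal G M en i))"
| connect:
    "path_partition G P ps \<Longrightarrow>
     tour_step G w (Connect P) (Output (close_up ps))"

abbreviation tour_init :: "'v pair_pre_digraph \<Rightarrow> 'v tour_state" where
  "tour_init G \<equiv> Greedy {} (parcs G)"

end

theory Submission
  imports Defs
begin

text \<open>A Hamiltonian cycle \<open>C\<close> is itself a matching, so it suffices to compare the matching \<open>M\<close> of the
  algorithm with \<open>C\<close> and to see that at most half of the value of \<open>M\<close> is lost when its cycles are
  opened.

  The greedy matching \<open>M\<^sub>1\<close> satisfies \<open>w C \<le> (2 + \<kappa>) w M\<^sub>1\<close> (\<open>greedy_approximation\<close>): an arc of
  \<open>C\<close> was rejected because of a conflicting arc, taken earlier and at least as valuable at that time, and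
  an arc of \<open>M\<^sub>1 - C\<close> conflicts with at most two arcs of \<open>C\<close>. This alone gives the factor 3 of an
  intersection of two matroids; curvature improves it to \<open>2 + \<kappa>\<close>, because adding \<open>M\<^sub>1\<close> to \<open>C\<close> still
  gains the fraction \<open>1 - \<kappa>\<close> of the marginal values of \<open>M\<^sub>1 - C\<close>. The assignment \<open>M\<^sub>2\<close> satisfies
  \<open>(1 - \<kappa>) w C \<le> w M\<^sub>2\<close> (\<open>assignment_approximation\<close>): it maximizes the additive function that
  bounds \<open>w\<close> from above by subadditivity and, after scaling by \<open>1 - \<kappa>\<close>, from below by curvature.

  Cycles of a matching are disjoint, so if the shortest has length \<open>k\<close> then there are \<open>k\<close> disjoint
  transversals, and by submodularity removing one of them costs at most \<open>w M / k\<close>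
  (\<open>ex_good_transversal\<close>). Since \<open>k \<ge> 2\<close>, half of the value is kept. What is left is a matching without
  cycles, hence a union of disjoint paths (\<open>acyclic_path_partition\<close>), and any way of joining them closes up
  to a Hamiltonian cycle, which by monotonicity is worth at least as much (\<open>close_up_hamiltonian\<close>).

  These facts are assembled in an invariant of the states of the algorithm. Every step preserves it and
  decreases a well-founded rank, and every state that satisfies it and is not an output has a successor.\<close>


section \<open>Marginals, curvature and removal of disjoint sets\<close>

lemma marginal_antimono:
  assumes "submodular E w" and "A \<subseteq> B" and "insert e B \<subseteq> E" and "e \<notin> B"
  shows "marginal w B e \<le> marginal w A e"
proof -
  have "w (insert e A \<union> B) + w (insert e A \<inter> B) \<le> w (insert e A) + w B"
    using assms(1)[unfolded submodular_def, rule_format, of "insert e A" B] assms by auto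
  moreover have "insert e A \<union> B = insert e B" "insert e A \<inter> B = A"
    using assms by auto
  ultimately show ?thesis by (simp add: marginal_def)
qed

lemma union_le_sum_marginals:
  assumes "submodular E w" and "finite B" and "A \<union> B \<subseteq> E"
  shows "w (A \<union> B) \<le> w A + (\<Sum>b \<in> B - A. marginal w A b)"
  using assms(2,3)
proof (induction B)
  case (insert b B)
  then have IH: "w (A \<union> B) \<le> w A + (\<Sum>b \<in> B - A. marginal w A b)" by simp
  show ?case
  proof (cases "b \<in> A")
    case True
    then show ?thesis using IH by (simp add: insert_absorb insert_Diff_if)
  next
    case False
    then have "marginal w (A \<union> B) b \<le> marginal w A b"
      using insert by (intro marginal_antimono[OF assms(1)]) auto
    then show ?thesis using IH insert False by (simp add: marginal_def insert_Diff_if)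
  qed
qed simp

lemma curvature_marginal:
  assumes "has_curvature E w \<kappa>" and "insert e A \<subseteq> E" and "e \<notin> A"
  shows "w A + (1 - \<kappa>) * w {e} \<le> w (insert e A)"
proof -
  have "A \<subset> E" "e \<in> E - A" using assms by auto
  then have "marginal w A e \<ge> (1 - \<kappa>) * w {e}" using assms(1) by (simp add: has_curvature_def)
  then show ?thesis by (simp add: marginal_def)
qed

lemma curvature_sum:
  assumes "has_curvature E w \<kappa>" and "finite B" and "B \<subseteq> E"
  shows "w {} + (1 - \<kappa>) * (\<Sum>b \<in> B. w {b}) \<le> w B"
  using assms(2,3)
proof (induction B)
  case (insert b B)
  then show ?case using curvature_marginal[OF assms(1), of b B] by (simp add: algebra_simps)
qed simp

text \<open>Diminishing returns: removing \<open>U i\<close> from the full set costs at most what removing it costs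
  after the other sets have been removed, and the latter costs telescope.\<close>

lemma disjoint_removal_losses:
  assumes "submodular E w" and "M \<subseteq> E" and "finite I"
    and "\<And>i. i \<in> I \<Longrightarrow> U i \<subseteq> M" and "disjoint_family_on U I"
  shows "(\<Sum>i \<in> I. w M - w (M - U i)) \<le> w M - w (M - (\<Union>i \<in> I. U i))"
  using assms(3-5)
proof (induction I)
  case (insert i I)
  let ?X = "\<Union>j \<in> I. U j"
  have IH: "(\<Sum>i \<in> I. w M - w (M - U i)) \<le> w M - w (M - ?X)"
    using insert by (auto simp: disjoint_family_on_def)
  have "U i \<inter> ?X = {}" using insert by (force simp: disjoint_family_on_def)
  then have "(M - U i) \<union> (M - ?X) = M" "(M - U i) \<inter> (M - ?X) = M - (U i \<union> ?X)" by auto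
  moreover have "w ((M - U i) \<union> (M - ?X)) + w ((M - U i) \<inter> (M - ?X)) \<le> w (M - U i) + w (M - ?X)"
    using assms(1)[unfolded submodular_def, rule_format, of "M - U i" "M - ?X"] assms(2) by auto
  ultimately show ?case using IH insert by simp
qed simp

lemma ex_is_arg_max:
  fixes f :: "'a \<Rightarrow> 'b::linorder"
  assumes "finite (f ` {x. P x})" and "P x"
  shows "\<exists>y. is_arg_max f P y"
proof -
  have "Max (f ` {x. P x}) \<in> f ` {x. P x}" using assms by (intro Max_in) auto
  then obtain y where "P y" "f y = Max (f ` {x. P x})" by auto
  then have "is_arg_max f P y"
    using assms(1) by (auto simp: is_arg_max_def not_less intro!: Max_ge)
  then show ?thesis ..
qed


section \<open>Cyclic arc sequences\<close>

lemma vwalk_arcs_zip: "vwalk_arcs xs = zip (butlast xs) (tl xs)"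
  by (induction xs rule: vwalk_arcs.induct) auto

lemma vwalk_arcs_closed: "xs \<noteq> [] \<Longrightarrow> vwalk_arcs (xs @ [hd xs]) = zip xs (rotate1 xs)"
  by (cases xs) (auto simp: vwalk_arcs_zip)

lemma pcas_iff: "pcas u p v \<longleftrightarrow> u # map snd p = map fst p @ [v]"
  by (induction p arbitrary: u) auto

lemma pawalk_verts_tails: "pcas u p v \<Longrightarrow> pawalk_verts u p = u # map snd p"
  by (induction p arbitrary: u) auto

text \<open>The vertex sequence of a closed walk can be read off its tails or its heads. Equating the two
  lists says at once that the arcs are consecutive and that the walk is closed; it makes properties of
  heads and of tails interchangeable.\<close>

lemma cycle_iff:
  "pre_digraph.cycle (spanning_sub G A) p \<longleftrightarrow>
     (\<exists>u \<in> pverts G. set p \<subseteq> A \<and> u # map snd p = map fst p @ [u] \<and> distinct (map snd p) \<and> p \<noteq> [])"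
  unfolding pre_digraph.cycle_def pre_digraph.awalk_def cas_with_proj_eq awalk_verts_with_proj_eq
  by (auto simp: pcas_iff[symmetric] pawalk_verts_tails)

lemma cycle_arc_setsE:
  assumes "C \<in> cycle_arc_sets G A"
  obtains p u where "C = set p" "set p \<subseteq> A" "u # map snd p = map fst p @ [u]"
    "distinct (map snd p)" "p \<noteq> []" "u \<in> pverts G"
  using assms by (auto simp: cycle_arc_sets_def cycle_iff)

lemma cycle_arc_setsI:
  assumes "set p \<subseteq> A" "u # map snd p = map fst p @ [u]"
    "distinct (map snd p)" "p \<noteq> []" "u \<in> pverts G"
  shows "set p \<in> cycle_arc_sets G A"
  using assms unfolding cycle_arc_sets_def by (intro imageI CollectI) (auto simp: cycle_iff)

lemma cycle_arc_sets_mono: "A \<subseteq> B \<Longrightarrow> cycle_arc_sets G A \<subseteq> cycle_arc_sets G B"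
  by (auto elim!: cycle_arc_setsE intro!: cycle_arc_setsI)

lemma closed_sequence_cycle:
  assumes "xs \<noteq> []" "distinct xs" "set xs \<subseteq> pverts G" "set (vwalk_arcs (xs @ [hd xs])) \<subseteq> A"
  shows "set (vwalk_arcs (xs @ [hd xs])) \<in> cycle_arc_sets G A"
  using assms by (intro cycle_arc_setsI[where u = "hd xs"]) (cases xs; auto simp: vwalk_arcs_zip)+

lemma
  assumes "C \<in> cycle_arc_sets G A"
  shows cycle_subset: "C \<subseteq> A" and cycle_nonempty: "C \<noteq> {}" and cycle_finite: "finite C"
    and cycle_inj_fst: "inj_on fst C" and cycle_inj_snd: "inj_on snd C"
    and cycle_heads_tails: "snd ` C = fst ` C"
proof -
  obtain p u where p: "C = set p" "set p \<subseteq> A" "u # map snd p = map fst p @ [u]"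
    "distinct (map snd p)" "p \<noteq> []" by (rule cycle_arc_setsE[OF assms])
  have "mset (map snd p) = mset (map fst p)" using arg_cong[OF p(3), of mset] by simp
  then have "distinct (map fst p)" "set (map snd p) = set (map fst p)"
    using p(4) mset_eq_imp_distinct_iff mset_eq_setD by blast+
  then show "C \<subseteq> A" "C \<noteq> {}" "finite C" "inj_on fst C" "inj_on snd C" "snd ` C = fst ` C"
    using p by (auto simp: distinct_map)
qed

text \<open>With out-degrees at most one, a cycle that has met another one can never leave it: the next arc
  is determined by the present one.\<close>

lemma intersecting_cycles_subset:
  assumes "inj_on fst M" and "C \<in> cycle_arc_sets G M" and "D \<in> cycle_arc_sets G M" and "C \<inter> D \<noteq> {}"
  shows "C \<subseteq> D"
proof -
  obtain p u where p: "C = set p" "set p \<subseteq> M" "u # map snd p = map fst p @ [u]" "p \<noteq> []"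
    by (rule cycle_arc_setsE[OF assms(2)])
  have follow: "f \<in> D" if "e \<in> D" "f \<in> C" "fst f = snd e" for e f
  proof -
    have "snd e \<in> fst ` D" using that cycle_heads_tails[OF assms(3)] by auto
    then obtain g where "g \<in> D" "fst g = snd e" by auto
    moreover from this have "g = f"
      using that assms(1) cycle_subset[OF assms(2)] cycle_subset[OF assms(3)]
      by (intro inj_onD[OF assms(1)]) auto
    ultimately show ?thesis by simp
  qed
  have step: "fst (p ! Suc i) = snd (p ! i)" if "Suc i < length p" for i
    using that arg_cong[OF p(3), of "\<lambda>l. l ! Suc i"] by (simp add: nth_append)
  have close: "fst (p ! 0) = snd (last p)"
  proof -
    have "u = fst (p ! 0)" using arg_cong[OF p(3), of hd] p(4) by (cases p) auto
    moreover have "u = snd (last p)" using arg_cong[OF p(3), of last] p(4) by (simp add: last_map)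
    ultimately show ?thesis by simp
  qed
  have onward: "p ! j \<in> D" if "p ! i \<in> D" "i \<le> j" "j < length p" for i j
    using that(2,3)
  proof (induction j rule: dec_induct)
    case (step n)
    then show ?case using follow[of "p ! n" "p ! Suc n"] \<open>\<And>i. Suc i < length p \<Longrightarrow> _ i\<close> p(1) by auto
  qed (use that in simp)
  obtain i where "i < length p" "p ! i \<in> D" using assms(4) p(1) by (metis disjoint_iff in_set_conv_nth)
  then have "last p \<in> D" using onward[of i "length p - 1"] p(4) by (simp add: last_conv_nth)
  then have "p ! 0 \<in> D" using follow[of "last p" "p ! 0"] close p by simp
  then show ?thesis using onward[of 0] p(1) by (metis in_set_conv_nth le0 subsetI)
qed

lemma intersecting_cycles_eq:
  assumes "inj_on fst M" and "C \<in> cycle_arc_sets G M" and "D \<in> cycle_arc_sets G M" and "C \<inter> D \<noteq> {}"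
  shows "C = D"
  using assms intersecting_cycles_subset[OF assms(1)] by (metis Int_commute subset_antisym)


section \<open>Cutting into paths and closing up\<close>

lemma vpath_spanning_sub:
  "vpath p (spanning_sub G A) \<longleftrightarrow>
     set p \<subseteq> pverts G \<and> set (vwalk_arcs p) \<subseteq> A \<and> p \<noteq> [] \<and> distinct p"
  by (auto simp: vpath_def vwalk_def)

lemma path_partition_permute:
  assumes "mset ps = mset qs" and "path_partition G A ps"
  shows "path_partition G A qs"
proof -
  have "set ps = set qs" using assms(1) by (rule mset_eq_setD)
  moreover have "mset (concat ps) = mset (concat qs)"
    using arg_cong[OF assms(1), of "image_mset mset"] by (simp add: mset_concat flip: sum_mset_sum_list)
  then have "distinct (concat ps) = distinct (concat qs)" by (rule mset_eq_imp_distinct_iff)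
  ultimately show ?thesis using assms(2) by (simp add: path_partition_def)
qed

lemma not_last_arc:
  assumes "x \<in> set p" and "x \<noteq> last p"
  shows "\<exists>y. (x, y) \<in> set (vwalk_arcs p)"
  using assms by (induction p rule: vwalk_arcs.induct) (auto split: if_splits)

lemma not_hd_arc:
  assumes "y \<in> set p" and "y \<noteq> hd p"
  shows "\<exists>x. (x, y) \<in> set (vwalk_arcs p)"
  using assms by (induction p rule: vwalk_arcs.induct) (auto split: if_splits)

text \<open>Adding the arcs one at a time, each new arc runs from the last vertex of one path to the first
  vertex of another path, which it joins; if both were the same path, the arc would close a cycle.\<close>

lemma acyclic_path_partition:
  assumes "finite (pverts G)" and "finite A" and "A \<subseteq> pverts G \<times> pverts G"
    and "inj_on fst A" and "inj_on snd A" and "cycle_arc_sets G A = {}"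
  shows "\<exists>ps. path_partition G A ps"
  using assms(2-)
proof (induction A)
  case empty
  obtain xs where "set xs = pverts G" "distinct xs" using assms(1) finite_distinct_list by blast
  then have "path_partition G {} (map (\<lambda>v. [v]) xs)"
    by (auto simp: path_partition_def vpath_spanning_sub)
  then show ?case ..
next
  case (insert e A)
  obtain u v where e: "e = (u, v)" by (cases e)
  have "cycle_arc_sets G A = {}" using insert.prems(4) cycle_arc_sets_mono[of A "insert e A" G] by auto
  then obtain ps where ps: "path_partition G A ps"
    using insert by (auto intro: inj_on_subset)
  have path: "set p \<subseteq> pverts G" "set (vwalk_arcs p) \<subseteq> A" "p \<noteq> []" "distinct p" if "p \<in> set ps" for p
    using ps that by (auto simp: path_partition_def vpath_spanning_sub)
  have cover: "\<Union> (set ` set ps) = pverts G" using ps by (simp add: path_partition_def)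
  obtain p where p: "p \<in> set ps" "u \<in> set p" using cover insert.prems(1) e by auto
  obtain q where q: "q \<in> set ps" "v \<in> set q" using cover insert.prems(1) e by auto
  have u: "u = last p"
  proof (rule ccontr)
    assume "u \<noteq> last p"
    then obtain y where "(u, y) \<in> A" using not_last_arc[OF p(2)] path[OF p(1)] by auto
    then show False using insert.prems(2) insert.hyps(2) e by (auto simp: image_iff)
  qed
  have v: "v = hd q"
  proof (rule ccontr)
    assume "v \<noteq> hd q"
    then obtain x where "(x, v) \<in> A" using not_hd_arc[OF q(2)] path[OF q(1)] by auto
    then show False using insert.prems(3) insert.hyps(2) e by (force simp: image_iff)
  qed
  have "p \<noteq> q"
  proof
    assume "p = q"
    then have "set (vwalk_arcs (p @ [hd p])) \<subseteq> insert e A"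
      using path[OF p(1)] u v e by (auto simp: set_vwalk_arcs_snoc)
    then have "set (vwalk_arcs (p @ [hd p])) \<in> cycle_arc_sets G (insert e A)"
      using path[OF p(1)] by (intro closed_sequence_cycle)
    then show False using insert.prems(4) by simp
  qed
  define rest where "rest = remove1 q (remove1 p ps)"
  have "q \<in> set (remove1 p ps)" using \<open>p \<noteq> q\<close> q(1) by simp
  then have "mset ps = mset (p # q # rest)"
    using p(1) unfolding rest_def by (metis insert_DiffM mset.simps(2) mset_remove1 set_mset_mset)
  then have pp: "path_partition G A (p # q # rest)" using ps by (rule path_partition_permute)
  have "set (vwalk_arcs (p @ q)) = insert e (set (vwalk_arcs p) \<union> set (vwalk_arcs q))"
    using path[OF p(1)] path[OF q(1)] u v e by (simp add: vwalk_arcs_append)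
  then have "path_partition G (insert e A) ((p @ q) # rest)"
    using pp by (auto simp: path_partition_def vpath_spanning_sub)
  then show ?case ..
qed

lemma close_up_contains:
  assumes "p \<in> set ps"
  shows "set (vwalk_arcs p) \<subseteq> close_up ps"
proof -
  obtain a b where "ps = a @ p # b" using assms by (auto simp: in_set_conv_decomp)
  then have "close_up ps = set (vwalk_arcs (concat a @ p @ (concat b @ [hd (concat ps)])))"
    by (simp add: close_up_def)
  then show ?thesis using set_vwalk_arcs_append1 set_vwalk_arcs_append2 by fastforce
qed


section \<open>The two candidate matchings\<close>

locale tour_instance =
  fixes G :: "'v pair_pre_digraph" and w :: "'v rel \<Rightarrow> real" and \<kappa> :: real
  assumes finite_V: "finite (pverts G)"
    and two_vertices: "2 \<le> card (pverts G)"
    and complete: "parcs G = {(u, v). u \<in> pverts G \<and> v \<in> pverts G \<and> u \<noteq> v}"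
    and nonneg: "A \<subseteq> parcs G \<Longrightarrow> 0 \<le> w A"
    and mono: "mono_on (Pow (parcs G)) w"
    and submod: "submodular (parcs G) w"
    and curv: "has_curvature (parcs G) w \<kappa>"
begin

abbreviation "E \<equiv> parcs G"
abbreviation "F \<equiv> matching_family G"
abbreviation "H \<equiv> hamiltonian_cycles G"

lemma E_subset: "E \<subseteq> pverts G \<times> pverts G"
  by (auto simp: complete)

lemma finite_E: "finite E"
  using E_subset finite_V finite_subset by blast

lemma kappa: "0 \<le> \<kappa>" "\<kappa> \<le> 1"
  using curv by (auto simp: has_curvature_def)

lemma w_mono: "A \<subseteq> B \<Longrightarrow> B \<subseteq> E \<Longrightarrow> w A \<le> w B"
  using mono by (auto simp: mono_on_def)

lemma matching_family_iff: "A \<in> F \<longleftrightarrow> A \<subseteq> E \<and> inj_on fst A \<and> inj_on snd A"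
proof (cases "A \<subseteq> E")
  case True
  then have fin: "finite A" using finite_E finite_subset by blast
  have out: "out_degree (spanning_sub G A) v \<le> 1 \<longleftrightarrow> (\<forall>e \<in> A. \<forall>f \<in> A. fst e = v \<longrightarrow> fst f = v \<longrightarrow> e = f)" for v
  proof -
    have *: "out_degree (spanning_sub G A) v = card {e \<in> A. fst e = v}"
      by (simp add: out_degree_def out_arcs_def)
    have "finite {e \<in> A. fst e = v}" using fin by simp
    then show ?thesis unfolding * One_nat_def by (subst card_le_Suc0_iff_eq) blast+
  qed
  have "in": "in_degree (spanning_sub G A) v \<le> 1 \<longleftrightarrow> (\<forall>e \<in> A. \<forall>f \<in> A. snd e = v \<longrightarrow> snd f = v \<longrightarrow> e = f)" for v
  proof -
    have *: "in_degree (spanning_sub G A) v = card {e \<in> A. snd e = v}"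
      by (simp add: in_degree_def in_arcs_def)
    have "finite {e \<in> A. snd e = v}" using fin by simp
    then show ?thesis unfolding * One_nat_def by (subst card_le_Suc0_iff_eq) blast+
  qed
  have V: "fst e \<in> pverts G" "snd e \<in> pverts G" if "e \<in> A" for e
    using that True E_subset by auto
  show ?thesis unfolding matching_family_def inj_on_def mem_Collect_eq out "in"
    using True by (intro iffI conjI ballI impI) (use V in blast)+
qed (auto simp: matching_family_def)

lemma finite_matching: "A \<in> F \<Longrightarrow> finite A"
  using finite_E finite_subset by (auto simp: matching_family_iff)

lemma matching_subset: "A \<in> F \<Longrightarrow> B \<subseteq> A \<Longrightarrow> B \<in> F"
  by (auto simp: matching_family_iff intro: inj_on_subset)

lemma
  assumes "C \<in> H"
  shows hamiltonian_matching: "C \<in> F" and hamiltonian_tails: "fst ` C = pverts G"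
    and hamiltonian_heads: "snd ` C = pverts G"
  using assms cycle_subset[of C G E] cycle_inj_fst[of C G E] cycle_inj_snd[of C G E]
    cycle_heads_tails[of C G E]
  by (auto simp: hamiltonian_cycles_def matching_family_iff)

definition conflict :: "'v \<times> 'v \<Rightarrow> 'v \<times> 'v \<Rightarrow> bool" where
  "conflict s a \<longleftrightarrow> fst s = fst a \<or> snd s = snd a"

text \<open>The charge \<open>\<delta> s\<close> stands for the marginal value that \<open>s\<close> had when it was added. Remembering
  only the charges makes the order of the additions dispensable. The third condition is the curvature bound,
  accumulated over the additions. For the last two: an arc that is still available was passed over each time
  that an arc was added, and its marginal value has only decreased since; an arc that is no longer available
  was discarded because of a conflict, and up to then it had been available.\<close>

definition charging :: "'v rel \<Rightarrow> 'v rel \<Rightarrow> ('v \<times> 'v \<Rightarrow> real) \<Rightarrow> bool" where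
  "charging M R \<delta> \<longleftrightarrow>
     (\<forall>s \<in> M. 0 \<le> \<delta> s) \<and>
     sum \<delta> M = w M - w {} \<and>
     (\<forall>C \<subseteq> E. w C + (1 - \<kappa>) * sum \<delta> (M - C) \<le> w (C \<union> M)) \<and>
     (\<forall>a \<in> R. \<forall>s \<in> M. marginal w M a \<le> \<delta> s) \<and>
     (\<forall>a \<in> E - M - R. \<exists>s \<in> M. conflict s a \<and> marginal w M a \<le> \<delta> s)"

definition greedy_inv :: "'v rel \<Rightarrow> 'v rel \<Rightarrow> bool" where
  "greedy_inv M R \<longleftrightarrow> M \<in> F \<and> R \<subseteq> E - M \<and> (\<exists>\<delta>. charging M R \<delta>)"

lemma greedy_inv_init: "greedy_inv {} E"
  by (auto simp: greedy_inv_def charging_def matching_family_iff)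

lemma greedy_inv_add:
  assumes "greedy_inv M R" and "is_arg_max (marginal w M) (\<lambda>e. e \<in> R) e" and "insert e M \<in> F"
  shows "greedy_inv (insert e M) (R - {e})"
proof -
  obtain \<delta> where \<delta>: "charging M R \<delta>" and R: "R \<subseteq> E - M" and M: "M \<in> F"
    using assms(1) by (auto simp: greedy_inv_def)
  have best: "marginal w M a \<le> marginal w M e" if "a \<in> R" for a
    using assms(2) that unfolding is_arg_max_linorder by blast
  have e: "e \<in> R" using assms(2) unfolding is_arg_max_linorder by blast
  then have eE: "e \<in> E" "e \<notin> M" using R by auto
  have ME: "M \<subseteq> E" "finite M" using M finite_matching by (auto simp: matching_family_iff)
  let ?d = "\<delta>(e := marginal w M e)"
  have d_sum: "sum ?d X = sum \<delta> X" if "e \<notin> X" for X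
    using that by (intro sum.cong) auto
  have d_sum_insert: "sum ?d (insert e X) = marginal w M e + sum \<delta> X" if "e \<notin> X" "finite X" for X
    unfolding sum.insert[OF that(2,1)] d_sum[OF that(1)] fun_upd_same ..
  have d_nonneg: "0 \<le> marginal w M e"
    using w_mono[of M "insert e M"] eE ME by (simp add: marginal_def subset_insertI)
  have d_single: "marginal w M e \<le> w {e}"
    using marginal_antimono[OF submod, of "{}" M e] nonneg[of "{}"] eE ME by (simp add: marginal_def)
  have decrease: "marginal w (insert e M) a \<le> marginal w M a" if "a \<in> E" "a \<notin> M" "a \<noteq> e" for a
    using that eE ME by (intro marginal_antimono[OF submod]) auto
  have "charging (insert e M) (R - {e}) ?d"
    unfolding charging_def
  proof (intro conjI ballI allI impI)
    show "0 \<le> ?d s" if "s \<in> insert e M" for s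
      using that d_nonneg \<delta> by (auto simp: charging_def)
    show "sum ?d (insert e M) = w (insert e M) - w {}"
      using \<delta> eE ME unfolding d_sum_insert[OF eE(2) ME(2)] by (simp add: charging_def marginal_def)
    show "w C + (1 - \<kappa>) * sum ?d (insert e M - C) \<le> w (C \<union> insert e M)" if C: "C \<subseteq> E" for C
    proof (cases "e \<in> C")
      case True
      then have "insert e M - C = M - C" "C \<union> insert e M = C \<union> M" by auto
      then show ?thesis using \<delta> C eE d_sum[of "M - C"] by (simp add: charging_def)
    next
      case False
      have "w (C \<union> M) + (1 - \<kappa>) * w {e} \<le> w (insert e (C \<union> M))"
        using False C eE ME by (intro curvature_marginal[OF curv]) auto
      moreover have "(1 - \<kappa>) * marginal w M e \<le> (1 - \<kappa>) * w {e}"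
        using d_single kappa by (intro mult_left_mono) auto
      moreover have "w C + (1 - \<kappa>) * sum \<delta> (M - C) \<le> w (C \<union> M)"
        using \<delta> C by (simp add: charging_def)
      moreover have "sum ?d (insert e M - C) = marginal w M e + sum \<delta> (M - C)"
        using False eE ME d_sum_insert[of "M - C"] by (simp add: insert_Diff_if)
      ultimately show ?thesis
        by (simp add: algebra_simps)
    qed
    show "marginal w (insert e M) a \<le> ?d s" if "a \<in> R - {e}" "s \<in> insert e M" for a s
    proof -
      have "marginal w (insert e M) a \<le> marginal w M a" using that R by (intro decrease) auto
      also have "\<dots> \<le> ?d s" using that \<delta> best[of a] by (auto simp: charging_def)
      finally show ?thesis .
    qed
    show "\<exists>s \<in> insert e M. conflict s a \<and> marginal w (insert e M) a \<le> ?d s"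
      if "a \<in> E - insert e M - (R - {e})" for a
    proof -
      have "a \<in> E - M - R" using that by auto
      then obtain s where "s \<in> M" "conflict s a" "marginal w M a \<le> \<delta> s"
        using \<delta> unfolding charging_def by blast
      then show ?thesis using decrease[of a] that eE by (intro bexI[of _ s]) auto
    qed
  qed
  then show ?thesis using assms(3) R by (auto simp: greedy_inv_def)
qed

lemma greedy_inv_discard:
  assumes "greedy_inv M R" and "e \<in> R" and "insert e M \<notin> F"
  shows "greedy_inv M (R - {e})"
proof -
  obtain \<delta> where \<delta>: "charging M R \<delta>" and R: "R \<subseteq> E - M" and M: "M \<in> F"
    using assms(1) by (auto simp: greedy_inv_def)
  obtain s where "s \<in> M" "conflict s e"
    using assms(2,3) R M unfolding matching_family_iff conflict_def by (auto simp: image_iff) metis+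
  then have "charging M (R - {e}) \<delta>"
    using \<delta> assms(2) unfolding charging_def by blast
  then show ?thesis using M R by (auto simp: greedy_inv_def)
qed

text \<open>Every arc of \<open>C\<close> that the greedy matching misses is charged to a conflicting arc. An arc of
  \<open>M\<close> is in conflict with at most two arcs of \<open>C\<close>, one for each end, and with no arc of \<open>C\<close> but itself if
  it lies in \<open>C\<close>. Hence the charges amount to at most twice those of \<open>M - C\<close>; the curvature
  bound returns a fraction \<open>1 - \<kappa>\<close> of the latter.\<close>

lemma greedy_approximation:
  assumes "greedy_inv M {}" and "C \<in> F"
  shows "w C \<le> (2 + \<kappa>) * w M"
proof -
  obtain \<delta> where \<delta>: "charging M {} \<delta>" and M: "M \<in> F"
    using assms(1) by (auto simp: greedy_inv_def)
  have ME: "M \<subseteq> E" "finite M" and CE: "C \<subseteq> E" "finite C"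
    using M assms(2) finite_matching by (auto simp: matching_family_iff)
  have "\<forall>a \<in> C - M. \<exists>s \<in> M. conflict s a \<and> marginal w M a \<le> \<delta> s"
    using \<delta> CE by (auto simp: charging_def)
  then obtain f where f: "\<And>a. a \<in> C - M \<Longrightarrow> f a \<in> M \<and> conflict (f a) a \<and> marginal w M a \<le> \<delta> (f a)"
    by metis
  let ?D = "sum \<delta> (M - C)"
  have half: "(\<Sum>a \<in> X. \<delta> (f a)) \<le> ?D"
    if X: "X \<subseteq> C - M" and g: "inj_on g C" and eq: "\<And>a. a \<in> X \<Longrightarrow> g (f a) = g a"
    for X and g :: "'v \<times> 'v \<Rightarrow> 'v"
  proof -
    have "inj_on f X"
      using X g by (intro inj_onI) (metis DiffD1 eq inj_onD subsetD)
    then have "(\<Sum>a \<in> X. \<delta> (f a)) = sum \<delta> (f ` X)" by (simp add: sum.reindex)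
    also have "\<dots> \<le> ?D"
    proof (rule sum_mono2)
      show "f ` X \<subseteq> M - C"
      proof
        fix s assume "s \<in> f ` X"
        then obtain a where a: "a \<in> X" "s = f a" by auto
        moreover have "f a \<notin> C"
        proof
          assume "f a \<in> C"
          then have "f a = a" using a X eq by (intro inj_onD[OF g]) auto
          then show False using f[of a] a X by auto
        qed
        ultimately show "s \<in> M - C" using f[of a] X by auto
      qed
    qed (use \<delta> ME in \<open>auto simp: charging_def\<close>)
    finally show ?thesis .
  qed
  \<comment> \<open>split the missed arcs by the end at which they meet the arc charged for them\<close>
  let ?X = "{a \<in> C - M. fst (f a) = fst a}"
  have "w C + (1 - \<kappa>) * ?D \<le> w (C \<union> M)" using \<delta> CE by (simp add: charging_def)
  also have "\<dots> \<le> w M + (\<Sum>a \<in> C - M. marginal w M a)"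
    using union_le_sum_marginals[OF submod, of C M] ME CE by (simp add: Un_commute)
  also have "(\<Sum>a \<in> C - M. marginal w M a) \<le> (\<Sum>a \<in> C - M. \<delta> (f a))"
    using f by (intro sum_mono) auto
  also have "\<dots> = (\<Sum>a \<in> ?X. \<delta> (f a)) + (\<Sum>a \<in> C - M - ?X. \<delta> (f a))"
    using CE by (subst sum.subset_diff[of ?X]) auto
  also have "\<dots> \<le> ?D + ?D"
  proof (rule add_mono)
    show "(\<Sum>a \<in> ?X. \<delta> (f a)) \<le> ?D"
      using assms(2) by (intro half[where g = fst]) (auto simp: matching_family_iff)
    show "(\<Sum>a \<in> C - M - ?X. \<delta> (f a)) \<le> ?D"
      using assms(2) f by (intro half[where g = snd]) (auto simp: matching_family_iff conflict_def)
  qed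
  finally have "w C \<le> w M + (1 + \<kappa>) * ?D" by (simp add: algebra_simps)
  moreover have "?D \<le> w M"
  proof -
    have "?D \<le> sum \<delta> M" using \<delta> ME by (intro sum_mono2) (auto simp: charging_def)
    also have "\<dots> \<le> w M" using \<delta> nonneg[of "{}"] by (simp add: charging_def)
    finally show ?thesis .
  qed
  then have "(1 + \<kappa>) * ?D \<le> (1 + \<kappa>) * w M" using kappa by (intro mult_left_mono) auto
  ultimately show ?thesis by (simp add: algebra_simps)
qed

lemma ex_greedy_choice:
  assumes "R \<subseteq> E" and "R \<noteq> {}"
  shows "\<exists>e. is_arg_max (marginal w M) (\<lambda>e. e \<in> R) e"
proof -
  have "finite R" using assms(1) finite_E by (rule finite_subset)
  moreover obtain e where "e \<in> R" using assms(2) by blast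
  ultimately show ?thesis using ex_is_arg_max[of "marginal w M" "\<lambda>e. e \<in> R" e] by simp
qed

abbreviation assignment_value :: "('v \<Rightarrow> 'v) \<Rightarrow> ereal" where
  "assignment_value \<tau> \<equiv> \<Sum>u \<in> pverts G. assignment_weight w u (\<tau> u)"

lemma ex_optimal_assignment: "\<exists>\<sigma>. optimal_assignment G w \<sigma>"
  unfolding optimal_assignment_def
proof (rule ex_is_arg_max)
  \<comment> \<open>infinitely many functions are bijections on the vertices, but their values off the vertices do not
    count\<close>
  have "assignment_value \<tau> \<in> assignment_value ` (pverts G \<rightarrow>\<^sub>E pverts G)"
    if "bij_betw \<tau> (pverts G) (pverts G)" for \<tau>
    using that by (intro image_eqI[of _ _ "restrict \<tau> (pverts G)"]) (auto simp: bij_betw_def)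
  then have "assignment_value ` {\<tau>. bij_betw \<tau> (pverts G) (pverts G)}
      \<subseteq> assignment_value ` (pverts G \<rightarrow>\<^sub>E pverts G)" by auto
  then show "finite (assignment_value ` {\<tau>. bij_betw \<tau> (pverts G) (pverts G)})"
    by (rule finite_subset) (simp add: finite_PiE finite_V)
  show "bij_betw id (pverts G) (pverts G)" by simp
qed

lemma hamiltonian_assignment:
  assumes "C \<in> H"
  obtains \<tau> where "bij_betw \<tau> (pverts G) (pverts G)" "assignment_value \<tau> = ereal (\<Sum>e \<in> C. w {e})"
proof
  let ?\<tau> = "snd \<circ> the_inv_into C fst"
  have C: "C \<subseteq> E" "inj_on fst C" "inj_on snd C"
    using hamiltonian_matching[OF assms] by (auto simp: matching_family_iff)
  have "bij_betw (the_inv_into C fst) (pverts G) C" "bij_betw snd C (pverts G)"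
    using C hamiltonian_tails[OF assms] hamiltonian_heads[OF assms]
    by (auto simp: bij_betw_def intro!: bij_betw_the_inv_into[unfolded bij_betw_def])
  then show "bij_betw ?\<tau> (pverts G) (pverts G)" by (rule bij_betw_trans)
  have "assignment_value ?\<tau> = (\<Sum>e \<in> C. assignment_weight w (fst e) (?\<tau> (fst e)))"
    using C(2) hamiltonian_tails[OF assms] sum.reindex[of fst C "\<lambda>u. assignment_weight w u (?\<tau> u)"]
    by simp
  also have "\<dots> = (\<Sum>e \<in> C. ereal (w {e}))"
    using C by (intro sum.cong) (auto simp: the_inv_into_f_f assignment_weight_def complete)
  finally show "assignment_value ?\<tau> = ereal (\<Sum>e \<in> C. w {e})" by simp
qed

text \<open>A fixed point would make the value \<open>- \<infinity>\<close>, and a Hamiltonian cycle is an assignment of finite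
  value.\<close>

lemma optimal_assignment_no_fixpoint:
  assumes "optimal_assignment G w \<sigma>" and "C \<in> H" and "u \<in> pverts G"
  shows "\<sigma> u \<noteq> u"
proof
  assume "\<sigma> u = u"
  then have "assignment_value \<sigma> = - \<infinity> + (\<Sum>u \<in> pverts G - {u}. assignment_weight w u (\<sigma> u))"
    using finite_V assms(3) by (subst sum.remove) (auto simp: assignment_weight_def)
  moreover have "(\<Sum>u \<in> pverts G - {u}. assignment_weight w u (\<sigma> u)) \<noteq> \<infinity>"
    by (subst sum_Pinfty) (auto simp: assignment_weight_def)
  ultimately have "assignment_value \<sigma> = - \<infinity>" by simp
  moreover obtain \<tau> where "bij_betw \<tau> (pverts G) (pverts G)" "assignment_value \<tau> = ereal (\<Sum>e \<in> C. w {e})"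
    by (rule hamiltonian_assignment[OF assms(2)])
  ultimately show False using assms(1) by (auto simp: optimal_assignment_def is_arg_max_linorder)
qed

text \<open>A Hamiltonian cycle is one of the assignments, and by subadditivity worth at most its assignment
  value. Curvature bounds the loss in passing from the assignment value of the optimal matching
  back to \<open>w\<close>.\<close>

lemma assignment_approximation:
  assumes "optimal_assignment G w \<sigma>" and "C \<in> H"
  defines "M \<equiv> (\<lambda>u. (u, \<sigma> u)) ` pverts G"
  shows "M \<in> F" and "(1 - \<kappa>) * w C \<le> w M"
proof -
  have bij: "bij_betw \<sigma> (pverts G) (pverts G)"
    using assms(1) by (auto simp: optimal_assignment_def is_arg_max_def)
  have nofix: "\<sigma> u \<noteq> u" "u \<noteq> \<sigma> u" if "u \<in> pverts G" for u
    using optimal_assignment_no_fixpoint assms(1,2) that by metis+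
  show M: "M \<in> F"
    using bij nofix by (auto simp: M_def matching_family_iff complete bij_betw_def inj_on_def)
  obtain \<tau> where "bij_betw \<tau> (pverts G) (pverts G)" "assignment_value \<tau> = ereal (\<Sum>e \<in> C. w {e})"
    by (rule hamiltonian_assignment[OF assms(2)])
  then have "ereal (\<Sum>e \<in> C. w {e}) \<le> assignment_value \<sigma>"
    using assms(1) by (auto simp: optimal_assignment_def is_arg_max_linorder)
  also have "assignment_value \<sigma> = (\<Sum>u \<in> pverts G. ereal (w {(u, \<sigma> u)}))"
    using nofix by (intro sum.cong) (auto simp: assignment_weight_def)
  also have "\<dots> = ereal (\<Sum>e \<in> M. w {e})"
    by (simp add: M_def sum.reindex inj_on_def)
  finally have opt: "(\<Sum>e \<in> C. w {e}) \<le> (\<Sum>e \<in> M. w {e})" by simp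
  have C: "C \<subseteq> E" "finite C" using hamiltonian_matching[OF assms(2)] finite_matching
    by (auto simp: matching_family_iff)
  have "w C \<le> w {} + (\<Sum>e \<in> C. w {e} - w {})"
    using union_le_sum_marginals[OF submod, of C "{}"] C by (simp add: marginal_def)
  also have "\<dots> \<le> w {} + (\<Sum>e \<in> C. w {e})"
    using nonneg[of "{}"] by (intro add_left_mono sum_mono) auto
  also have "\<dots> \<le> w {} + (\<Sum>e \<in> M. w {e})" using opt by simp
  finally have "(1 - \<kappa>) * w C \<le> (1 - \<kappa>) * w {} + (1 - \<kappa>) * (\<Sum>e \<in> M. w {e})"
    using kappa by (metis diff_ge_0_iff_ge distrib_left mult_left_mono)
  also have "(1 - \<kappa>) * w {} \<le> w {}"
    using kappa nonneg[of "{}"] by (simp add: mult_left_le_one_le)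
  also have "w {} + (1 - \<kappa>) * (\<Sum>e \<in> M. w {e}) \<le> w M"
    using M finite_matching by (intro curvature_sum[OF curv]) (auto simp: matching_family_iff)
  finally show "(1 - \<kappa>) * w C \<le> w M" by simp
qed


section \<open>Removing a transversal\<close>

lemma cycle_length_ge_2:
  assumes "A \<in> cycle_arc_sets G M" and "M \<subseteq> E"
  shows "2 \<le> card A"
proof -
  have "finite A" "A \<noteq> {}" using assms(1) by (rule cycle_finite, rule cycle_nonempty)
  moreover have "card A \<noteq> 1"
  proof
    assume "card A = 1"
    then obtain e where "A = {e}" by (auto simp: card_1_singleton_iff)
    then have "snd e = fst e" using cycle_heads_tails[OF assms(1)] by simp
    moreover have "e \<in> E" using cycle_subset[OF assms(1)] assms(2) \<open>A = {e}\<close> by auto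
    ultimately show False by (auto simp: complete)
  qed
  ultimately show ?thesis using card_gt_0_iff[of A] by linarith
qed

lemma finite_cycles: "M \<in> F \<Longrightarrow> finite (cycle_arc_sets G M)"
  by (rule finite_subset[of _ "Pow M"]) (auto dest: cycle_subset finite_matching)

lemma ex_enumeration: "\<exists>en. enumerates_cycles G M en"
proof -
  have "\<exists>f. bij_betw f {1..card A} A" if "A \<in> cycle_arc_sets G M" for A
    using finite_same_card_bij[of "{1..card A}" A] cycle_finite[OF that] by simp
  then show ?thesis unfolding enumerates_cycles_def by metis
qed

lemma enum_mem:
  assumes "enumerates_cycles G M en" and "A \<in> cycle_arc_sets G M" and "1 \<le> i" and "i \<le> card A"
  shows "en A i \<in> A"
proof -
  have "bij_betw (en A) {1..card A} A" using assms(1,2) by (simp add: enumerates_cycles_def)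
  from bij_betwE[OF this] show ?thesis using assms(3,4) by simp
qed

lemma disjoint_transversals:
  assumes "M \<in> F" and "enumerates_cycles G M en" and "\<forall>A \<in> cycle_arc_sets G M. k \<le> card A"
  shows "disjoint_family_on (transversal G M en) {1..k}"
  unfolding disjoint_family_on_def
proof (intro ballI impI)
  fix i j assume ij: "i \<in> {1..k}" "j \<in> {1..k}" "i \<noteq> j"
  show "transversal G M en i \<inter> transversal G M en j = {}"
  proof (rule ccontr)
    assume "transversal G M en i \<inter> transversal G M en j \<noteq> {}"
    then obtain A B where AB: "A \<in> cycle_arc_sets G M" "B \<in> cycle_arc_sets G M" "en A i = en B j"
      unfolding transversal_def by blast
    have i: "i \<in> {1..card A}" "j \<in> {1..card B}" using ij AB assms(3) by (auto intro: order_trans)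
    then have "en A i \<in> A" "en B j \<in> B"
      using enum_mem[OF assms(2) AB(1)] enum_mem[OF assms(2) AB(2)] by auto
    then have "A = B" using AB assms(1)
      by (intro intersecting_cycles_eq[of M A G B]) (auto simp: matching_family_iff)
    moreover have "inj_on (en A) {1..card A}"
      using assms(2) AB by (auto simp: enumerates_cycles_def bij_betw_def)
    ultimately show False using AB(3) i ij(3) by (auto dest: inj_onD)
  qed
qed

text \<open>The \<open>k\<close> transversals are disjoint, so their losses add up to at most \<open>w M\<close>, and one of them is
  at most the average. When there is no cycle, nothing is removed, and the test succeeds at once, because
  \<open>(k - 1) / k \<le> 1\<close> for whatever natural number \<open>k\<close> the minimum of the empty set denotes.\<close>

lemma ex_good_transversal:
  assumes "M \<in> F" and "enumerates_cycles G M en"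
  shows "\<exists>i \<ge> 1. (\<forall>A \<in> cycle_arc_sets G M. i \<le> card A) \<and> removal_ok G w M en i"
proof (cases "cycle_arc_sets G M = {}")
  case True
  define k where "k = real (min_cycle_length G M)"
  have "0 \<le> w M" using assms(1) nonneg by (auto simp: matching_family_iff)
  moreover have "(k - 1) / k \<le> 1" by (cases "k = 0") (auto simp: k_def divide_simps)
  ultimately have "(k - 1) / k * w M \<le> 1 * w M" by (intro mult_right_mono)
  then show ?thesis using True by (auto simp: removal_ok_def transversal_def k_def)
next
  case False
  let ?k = "min_cycle_length G M" and ?U = "transversal G M en"
  have ME: "M \<subseteq> E" using assms(1) by (simp add: matching_family_iff)
  have fin: "finite (card ` cycle_arc_sets G M)" using finite_cycles[OF assms(1)] by simp
  have le: "?k \<le> card A" if "A \<in> cycle_arc_sets G M" for A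
    using that fin by (simp add: min_cycle_length_def)
  have "?k \<in> card ` cycle_arc_sets G M"
    unfolding min_cycle_length_def using fin False by (intro Min_in) auto
  then have k: "2 \<le> ?k" using cycle_length_ge_2 ME by auto
  have "\<exists>i \<in> {1..?k}. removal_ok G w M en i"
  proof (rule ccontr)
    assume "\<not> ?thesis"
    then have bad: "w M / ?k < w M - w (M - ?U i)" if "i \<in> {1..?k}" for i
      using that k by (auto simp: removal_ok_def not_le divide_simps algebra_simps)
    have "w M = (\<Sum>i = 1..?k. w M / ?k)" using k by simp
    also have "\<dots> < (\<Sum>i = 1..?k. w M - w (M - ?U i))"
      using bad k by (intro sum_strict_mono) auto
    also have "\<dots> \<le> w M - w (M - (\<Union>i \<in> {1..?k}. ?U i))"
    proof (rule disjoint_removal_losses[OF submod ME])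
      show "?U i \<subseteq> M" if "i \<in> {1..?k}" for i
      proof -
        have "en A i \<in> M" if A: "A \<in> cycle_arc_sets G M" for A
          using enum_mem[OF assms(2) A, of i] le[OF A] cycle_subset[OF A] \<open>i \<in> {1..?k}\<close> by auto
        then show ?thesis by (auto simp: transversal_def)
      qed
      show "disjoint_family_on ?U {1..?k}"
        using le by (intro disjoint_transversals assms) auto
    qed simp
    also have "\<dots> \<le> w M" using nonneg[of "M - (\<Union>i \<in> {1..?k}. ?U i)"] ME by auto
    finally show False by simp
  qed
  then obtain i where "1 \<le> i" "i \<le> ?k" "removal_ok G w M en i" by auto
  then show ?thesis using le order_trans by blast
qed

lemma removal_keeps_half:
  assumes "M \<in> F" and "removal_ok G w M en i"
  shows "w M \<le> 2 * w (M - transversal G M en i)"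
proof (cases "cycle_arc_sets G M = {}")
  case True
  then show ?thesis using nonneg[of M] assms(1) by (simp add: transversal_def matching_family_iff)
next
  case False
  define k where "k = real (min_cycle_length G M)"
  have "min_cycle_length G M \<in> card ` cycle_arc_sets G M"
    unfolding min_cycle_length_def using finite_cycles[OF assms(1)] False by (intro Min_in) auto
  then have "2 \<le> k" using cycle_length_ge_2 assms(1) by (auto simp: matching_family_iff k_def)
  then have "1 / 2 \<le> (k - 1) / k" by (simp add: divide_simps)
  then have "1 / 2 * w M \<le> (k - 1) / k * w M"
    using nonneg[of M] assms(1) by (intro mult_right_mono) (auto simp: matching_family_iff)
  then show ?thesis using assms(2) unfolding removal_ok_def k_def[symmetric] by linarith
qed

text \<open>A cycle in what is left would be one of the cycles of \<open>M\<close>, but each of those has lost an arc.\<close>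

lemma removal_acyclic:
  assumes "enumerates_cycles G M en" and "1 \<le> i" and "\<forall>A \<in> cycle_arc_sets G M. i \<le> card A"
  shows "cycle_arc_sets G (M - transversal G M en i) = {}"
proof (rule ccontr)
  assume "\<not> ?thesis"
  then obtain A where A: "A \<in> cycle_arc_sets G (M - transversal G M en i)" by auto
  then have "A \<in> cycle_arc_sets G M" using cycle_arc_sets_mono[of "M - transversal G M en i" M G] by auto
  then have "en A i \<in> A" "en A i \<in> transversal G M en i"
    using assms by (auto intro: enum_mem simp: transversal_def)
  then show False using cycle_subset[OF A] by auto
qed

lemma close_up_hamiltonian:
  assumes "path_partition G P ps"
  shows "close_up ps \<in> H" and "P \<subseteq> close_up ps"
proof -
  let ?xs = "concat ps"
  have xs: "distinct ?xs" "set ?xs = pverts G" using assms by (auto simp: path_partition_def)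
  then have len: "2 \<le> length ?xs" using two_vertices distinct_card by metis
  then have ne: "?xs \<noteq> []" by force
  have zip: "vwalk_arcs (?xs @ [hd ?xs]) = zip ?xs (rotate1 ?xs)" using ne by (rule vwalk_arcs_closed)
  have "set (vwalk_arcs (?xs @ [hd ?xs])) \<subseteq> E"
  proof
    fix e assume "e \<in> set (vwalk_arcs (?xs @ [hd ?xs]))"
    then obtain i where i: "i < length ?xs" "e = (?xs ! i, rotate1 ?xs ! i)"
      unfolding zip by (auto simp: set_zip)
    have "Suc i mod length ?xs \<noteq> i" using i(1) len by (cases "Suc i = length ?xs") auto
    then have "?xs ! i \<noteq> ?xs ! (Suc i mod length ?xs)"
      using nth_eq_iff_index_eq[OF xs(1)] i(1) by (metis mod_less_divisor gr_implies_not0 neq0_conv)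
    moreover have "?xs ! i \<in> pverts G" "?xs ! (Suc i mod length ?xs) \<in> pverts G"
      using i(1) xs(2) nth_mem by (metis, metis mod_less_divisor gr_implies_not0 neq0_conv)
    ultimately show "e \<in> E" using i by (simp add: complete nth_rotate1)
  qed
  then have "close_up ps \<in> cycle_arc_sets G E"
    unfolding close_up_def using xs ne by (intro closed_sequence_cycle) auto
  moreover have "fst ` close_up ps = pverts G"
    using xs(2) map_fst_zip[of ?xs "rotate1 ?xs"] unfolding close_up_def zip
    by (metis length_rotate1 list.set_map)
  ultimately show "close_up ps \<in> H" by (simp add: hamiltonian_cycles_def)
  show "P \<subseteq> close_up ps"
    using assms close_up_contains by (fastforce simp: path_partition_def)
qed

lemma ex_hamiltonian: "\<exists>C. C \<in> H"
proof -
  have "cycle_arc_sets G {} = {}" by (auto elim: cycle_arc_setsE)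
  then obtain ps where "path_partition G {} ps"
    using acyclic_path_partition[of G "{}"] finite_V by auto
  then show ?thesis using close_up_hamiltonian by blast
qed


section \<open>Executions\<close>

text \<open>The conditions at \<open>Scan\<close> make the scan succeed before it runs past the end of a cycle: the first
  index not rejected so far is at most the first acceptable one, which no cycle falls short of.\<close>

abbreviation ratio :: real where
  "ratio \<equiv> max (1 / (2 + \<kappa>)) (1 - \<kappa>)"

primrec state_inv :: "'v tour_state \<Rightarrow> bool" where
  "state_inv (Greedy M R) = greedy_inv M R"
| "state_inv (Assign M\<^sub>1) = (M\<^sub>1 \<in> F \<and> (\<forall>C \<in> H. w C \<le> (2 + \<kappa>) * w M\<^sub>1))"
| "state_inv (Select M\<^sub>1 M\<^sub>2) =
     (M\<^sub>1 \<in> F \<and> (\<forall>C \<in> H. w C \<le> (2 + \<kappa>) * w M\<^sub>1) \<and> M\<^sub>2 \<in> F \<and> (\<forall>C \<in> H. (1 - \<kappa>) * w C \<le> w M\<^sub>2))"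
| "state_inv (Scan M en i) =
     (M \<in> F \<and> (\<forall>C \<in> H. ratio * w C \<le> w M) \<and> enumerates_cycles G M en \<and> 1 \<le> i \<and>
      (\<forall>A \<in> cycle_arc_sets G M. i \<le> card A) \<and> (\<forall>j. 1 \<le> j \<and> j < i \<longrightarrow> \<not> removal_ok G w M en j))"
| "state_inv (Connect P) =
     (P \<in> F \<and> cycle_arc_sets G P = {} \<and> (\<forall>C \<in> H. ratio * w C \<le> 2 * w P))"
| "state_inv (Output T) = (T \<in> H \<and> (\<forall>C \<in> H. ratio * w C \<le> 2 * w T))"

lemma state_inv_init: "state_inv (tour_init G)"
  by (simp add: greedy_inv_init)

lemma state_inv_step:
  assumes "tour_step G w s s'" and "state_inv s"
  shows "state_inv s'"
  using assms
proof (induction rule: tour_step.induct)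
  case (greedy_add M R e)
  then show ?case by (simp add: greedy_inv_add)
next
  case (greedy_discard M R e)
  then show ?case by (simp add: greedy_inv_discard is_arg_max_def)
next
  case (greedy_done M)
  then show ?case
    using greedy_approximation hamiltonian_matching by (simp add: greedy_inv_def)
next
  case (assign \<sigma> M\<^sub>1)
  then show ?case using assignment_approximation ex_hamiltonian by auto
next
  case (select M M\<^sub>1 M\<^sub>2 en)
  have "M \<in> F" using select by auto
  moreover have "ratio * w C \<le> w M" if C: "C \<in> H" for C
  proof -
    have "1 / (2 + \<kappa>) * w C \<le> w M\<^sub>1" "(1 - \<kappa>) * w C \<le> w M\<^sub>2"
      using select C kappa by (auto simp: divide_simps mult.commute)
    moreover have "w M\<^sub>1 \<le> w M" "w M\<^sub>2 \<le> w M" using select by auto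
    ultimately show ?thesis by (auto simp: max_def)
  qed
  moreover have "1 \<le> card A" if "A \<in> cycle_arc_sets G M" for A
    using cycle_length_ge_2[OF that] \<open>M \<in> F\<close> by (auto simp: matching_family_iff)
  ultimately show ?case using select by auto
next
  case (scan_next M i en)
  then obtain i\<^sub>0 where i\<^sub>0: "i\<^sub>0 \<ge> 1" "\<forall>A \<in> cycle_arc_sets G M. i\<^sub>0 \<le> card A" "removal_ok G w M en i\<^sub>0"
    using ex_good_transversal[of M en] by auto
  have "i < i\<^sub>0" using i\<^sub>0 scan_next by (metis linorder_neqE_nat state_inv.simps(4))
  then have "\<forall>A \<in> cycle_arc_sets G M. Suc i \<le> card A" using i\<^sub>0(2) by auto
  then show ?case using scan_next by (auto simp: less_Suc_eq)
next
  case (scan_stop M i en)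
  then have M: "M \<in> F" and half: "w M \<le> 2 * w (M - transversal G M en i)"
    by (auto intro: removal_keeps_half)
  have "ratio * w C \<le> 2 * w (M - transversal G M en i)" if "C \<in> H" for C
    using scan_stop.prems half that by (force intro: order_trans)
  then show ?case using scan_stop removal_acyclic matching_subset[OF M] by auto
next
  case (connect P ps)
  have T: "close_up ps \<in> H" "P \<subseteq> close_up ps" using close_up_hamiltonian connect by auto
  then have "w P \<le> w (close_up ps)"
    using hamiltonian_matching by (intro w_mono) (auto simp: matching_family_iff)
  then have "ratio * w C \<le> 2 * w (close_up ps)" if "C \<in> H" for C
    using connect.prems that by (force intro: order_trans)
  then show ?case using T by simp
qed

lemma state_inv_progress:
  assumes "state_inv s" and "\<nexists>T. s = Output T"
  shows "\<exists>s'. tour_step G w s s'"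
proof (cases s)
  case (Greedy M R)
  show ?thesis
  proof (cases "R = {}")
    case True
    then show ?thesis using Greedy greedy_done by blast
  next
    case False
    have "R \<subseteq> E" using assms(1) Greedy by (auto simp: greedy_inv_def)
    then obtain e where "is_arg_max (marginal w M) (\<lambda>e. e \<in> R) e"
      using ex_greedy_choice[OF _ False] by blast
    then show ?thesis using Greedy greedy_add greedy_discard by blast
  qed
next
  case (Assign M)
  then show ?thesis using ex_optimal_assignment assign by blast
next
  case (Select M\<^sub>1 M\<^sub>2)
  obtain M where "M \<in> {M\<^sub>1, M\<^sub>2}" "w M = max (w M\<^sub>1) (w M\<^sub>2)" by (metis insertCI max_def)
  then show ?thesis using Select ex_enumeration select by blast
next
  case (Scan M en i)
  then show ?thesis using assms(1) scan_next scan_stop by (metis state_inv.simps(4))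
next
  case (Connect P)
  then have "P \<in> F" "cycle_arc_sets G P = {}" using assms(1) by auto
  then have "\<exists>ps. path_partition G P ps"
    using finite_V E_subset finite_matching
    by (intro acyclic_path_partition) (auto simp: matching_family_iff)
  then show ?thesis using Connect connect by blast
next
  case (Output T)
  then show ?thesis using assms(2) by auto
qed

text \<open>The first component orders the phases. In the scan, the least acceptable index exists by
  \<open>ex_good_transversal\<close> and stays ahead of every rejected one.\<close>

primrec rank :: "'v tour_state \<Rightarrow> nat \<times> nat" where
  "rank (Greedy M R) = (5, card R)"
| "rank (Assign M) = (4, 0)"
| "rank (Select M\<^sub>1 M\<^sub>2) = (3, 0)"
| "rank (Scan M en i) = (2, (LEAST j. 1 \<le> j \<and> removal_ok G w M en j) - i)"
| "rank (Connect P) = (1, 0)"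
| "rank (Output T) = (0, 0)"

lemma rank_decreases:
  assumes "tour_step G w s s'" and "state_inv s"
  shows "(rank s', rank s) \<in> less_than <*lex*> less_than"
  using assms
proof (induction rule: tour_step.induct)
  case (greedy_add M R e)
  then have "e \<in> R" "finite R"
    using finite_E by (auto simp: greedy_inv_def is_arg_max_def intro: finite_subset)
  then show ?case using card_Diff1_less by fastforce
next
  case (greedy_discard M R e)
  then have "e \<in> R" "finite R"
    using finite_E by (auto simp: greedy_inv_def is_arg_max_def intro: finite_subset)
  then show ?case using card_Diff1_less by fastforce
next
  case (scan_next M i en)
  let ?L = "LEAST j. 1 \<le> j \<and> removal_ok G w M en j"
  have "\<exists>j. 1 \<le> j \<and> removal_ok G w M en j" using ex_good_transversal[of M en] scan_next by auto
  then have "1 \<le> ?L \<and> removal_ok G w M en ?L" by (rule LeastI_ex)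
  then have "i < ?L" using scan_next by (metis linorder_neqE_nat state_inv.simps(4))
  then show ?case by auto
qed auto

lemma no_infinite_run:
  "\<nexists>run. run 0 = tour_init G \<and> (\<forall>i. tour_step G w (run i) (run (Suc i)))"
proof
  assume "\<exists>run. run 0 = tour_init G \<and> (\<forall>i. tour_step G w (run i) (run (Suc i)))"
  then obtain run where run: "run 0 = tour_init G" "\<And>i. tour_step G w (run i) (run (Suc i))" by auto
  have "state_inv (run i)" for i
    by (induction i) (use run state_inv_init state_inv_step in \<open>auto simp del: state_inv.simps\<close>)
  then have "\<forall>i. (rank (run (Suc i)), rank (run i)) \<in> less_than <*lex*> less_than"
    using run rank_decreases by blast
  moreover have "wf (less_than <*lex*> less_than)" by (intro wf_lex_prod wf_less_than)
  ultimately show False 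
    using wf_no_infinite_down_chainE[of _ "\<lambda>i. rank (run i)"] by blast
qed

lemma final_state:
  assumes "(tour_step G w)\<^sup>*\<^sup>* (tour_init G) s" and "\<nexists>s'. tour_step G w s s'"
  shows "\<exists>T. s = Output T \<and> T \<in> H \<and>
    w T \<ge> max (1 / (2 * (2 + \<kappa>))) (1 / 2 * (1 - \<kappa>)) * Max (w ` H)"
proof -
  have "state_inv s"
    using assms(1) by (induction rule: rtranclp_induct) (auto simp: greedy_inv_init dest: state_inv_step)
  then obtain T where s: "s = Output T" and T: "T \<in> H" "\<forall>C \<in> H. ratio * w C \<le> 2 * w T"
    using state_inv_progress assms(2) by (metis state_inv.simps(6))
  have "finite H"
    by (rule finite_subset[of _ "Pow E"]) (auto simp: finite_E dest!: hamiltonian_matching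
        simp: matching_family_iff)
  then have "Max (w ` H) \<in> w ` H" using T(1) by (intro Max_in) auto
  then have "ratio * Max (w ` H) \<le> 2 * w T" using T(2) by auto
  then have "ratio / 2 * Max (w ` H) \<le> w T"
    unfolding times_divide_eq_left by (intro iffD2[OF divide_le_eq_numeral1(1)]) (simp only: mult.commute)
  moreover have half: "max (1 / (2 * (2 + \<kappa>))) (1 / 2 * (1 - \<kappa>)) = ratio / 2"
  proof -
    have "max (a / 2) (1 / 2 * b) = max a b / 2" for a b :: real by (simp add: max_def)
    from this[of "1 / (2 + \<kappa>)" "1 - \<kappa>"] show ?thesis by (simp only: divide_divide_eq_left mult.commute)
  qed
  ultimately show ?thesis using s T(1) unfolding half by blast
qed

end

theorem mainTheorem5:
  fixes G :: "'v pair_pre_digraph" and n :: nat and w :: "'v rel \<Rightarrow> real" and \<kappa> :: real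
  assumes "K\<^bsub>n\<^esub> (with_proj G)" and "n \<ge> 2"
    and "\<forall>A \<subseteq> parcs G. w A \<ge> 0"
    and "mono_on (Pow (parcs G)) w"
    and "submodular (parcs G) w"
    and "has_curvature (parcs G) w \<kappa>"
  shows
    \<comment> \<open>every execution terminates, and the state in which it ends is an output as claimed\<close>
    "(\<nexists>run. run 0 = tour_init G \<and> (\<forall>i. tour_step G w (run i) (run (Suc i)))) \<and>
     (\<forall>s. (tour_step G w)\<^sup>*\<^sup>* (tour_init G) s \<and> (\<nexists>s'. tour_step G w s s') \<longrightarrow>
        (\<exists>T. s = Output T \<and> T \<in> hamiltonian_cycles G \<and>
             w T \<ge> max (1 / (2 * (2 + \<kappa>))) (1 / 2 * (1 - \<kappa>)) * Max (w ` hamiltonian_cycles G)))"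
proof -
  have K: "finite (pverts G)" "card (pverts G) = n"
    "parcs G = {(u, v). u \<in> pverts G \<and> v \<in> pverts G \<and> u \<noteq> v}"
    using assms(1) unfolding complete_digraph_pair_def by auto
  interpret tour_instance G w \<kappa>
  proof
    show "2 \<le> card (pverts G)" using K(2) assms(2) by simp
    show "0 \<le> w A" if "A \<subseteq> parcs G" for A using assms(3) that by blast
  qed (fact K assms)+
  show ?thesis using no_infinite_run final_state by blast
qed

end
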